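(* Let $T>0$ be the total evolution time of the adiabatic model $H=H_0+zH_f$, with $H_0=-|\phi\rangle\langle\phi|$, $|\phi\rangle=\frac1{\sqrt N}\sum_s|s\rangle$, $H_f=\sum_sE(s)|s\rangle\langle s|$ and an arbitrary (possibly non-linear) real schedule $z=z(t)$, $t\in[0,T]$. Let $\psi(t)$ be the solution of $i\partial_t|\psi(t)\rangle=H|\psi(t)\rangle$ with $|\psi(0)\rangle=|\phi\rangle$. Let $P$ be the orthogonal projector onto the ground state subspace of $H_f$, with degeneracy $N_0$, and define $p:=\langle\psi(T)|P|\psi(T)\rangle$, with $p>0$. Then $$\sqrt{\frac{N}{N_0}}\;\gamma\le T,\qquad \gamma:=\frac p2\,\frac{\left(1-\sqrt{\frac{N_0}{Np}}\right)^2}{1+\sqrt p},$$ with $\gamma$ a constant of $O(1)$.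
   Context: Let $n\ge1$, $N=2^n$, and let $s$ range over the $N$ assignments of $n$ binary variables; $\{|s\rangle\}$ is the computational (orthonormal) basis of $\mathbb C^N$. The cost function $E(s)$ takes integer values in $\{0,\dots,m\}$, $m=\mathrm{poly}(n)$. $N_0$ is the number of $s$ with $E(s)=0$, and it is assumed that $N_0>0$; hence the ground energy of $H_f$ is $0$ and its ground state subspace is $\mathrm{Span}\{|s\rangle: E(s)=0\}$, of dimension $N_0$. Units are such that $\hbar=1$. *)

theory Defs
  imports Jordan_Normal_Form.Schur_Decomposition "HOL-Library.Landau_Symbols"
begin

definition assignments :: "nat \<Rightarrow> bool list set" where
  "assignments n = {s. length s = n}"

text \<open>The basis vector \<open>|s\<rangle>\<close>: the coordinates are numbered by reading an assignment as a binary number.\<close>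

definition ket :: "bool list \<Rightarrow> complex vec" where
  "ket s = unit_vec (2 ^ length s) (horner_sum of_bool 2 s)"

text \<open>The operator \<open>|u\<rangle>\<langle>v|\<close>.\<close>

definition outer :: "complex vec \<Rightarrow> complex vec \<Rightarrow> complex mat" where
  "outer u v = mat (dim_vec u) (dim_vec v) (\<lambda>(i, j). u $ i * cnj (v $ j))"

definition uniform_state :: "nat \<Rightarrow> complex vec" where
  "uniform_state n =
     vec (2 ^ n) (\<lambda>i. complex_of_real (1 / sqrt (2 ^ n)) * (\<Sum>s\<in>assignments n. ket s $ i))"

definition initial_hamiltonian :: "nat \<Rightarrow> complex mat" where
  "initial_hamiltonian n = - outer (uniform_state n) (uniform_state n)"

definition cost_hamiltonian :: "nat \<Rightarrow> (bool list \<Rightarrow> nat) \<Rightarrow> complex mat" where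
  "cost_hamiltonian n E =
     mat (2 ^ n) (2 ^ n)
       (\<lambda>(i, j). \<Sum>s\<in>assignments n. (of_nat (E s) \<cdot>\<^sub>m outer (ket s) (ket s)) $$ (i, j))"

definition adiabatic_hamiltonian :: "nat \<Rightarrow> (bool list \<Rightarrow> nat) \<Rightarrow> real \<Rightarrow> complex mat" where
  "adiabatic_hamiltonian n E z =
     initial_hamiltonian n + complex_of_real z \<cdot>\<^sub>m cost_hamiltonian n E"

text \<open>
  Solutions of \<open>\<i> \<partial>\<^sub>t \<psi> = H \<psi>\<close> in \<open>\<complex>\<^sup>d\<close> on \<open>[0, T]\<close>. The solution is continuous and satisfies the
  equation except possibly at finitely many times; this admits Hamiltonians \<open>H\<close> with jumps
  (for instance a piecewise constant schedule), at which no derivative exists.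
  If \<open>H\<close> is continuous, this is the same as satisfying the equation everywhere.
\<close>

definition schroedinger_solution ::
    "nat \<Rightarrow> real \<Rightarrow> (real \<Rightarrow> complex mat) \<Rightarrow> (real \<Rightarrow> complex vec) \<Rightarrow> bool" where
  "schroedinger_solution d T H \<psi> \<longleftrightarrow>
     (\<forall>t\<in>{0..T}. \<psi> t \<in> carrier_vec d) \<and>
     (\<forall>k<d. continuous_on {0..T} (\<lambda>t. \<psi> t $ k)) \<and>
     (\<exists>S. finite S \<and>
        (\<forall>t\<in>{0..T} - S. \<forall>k<d.
           ((\<lambda>t. \<psi> t $ k) has_vector_derivative (- \<i> * (H t *\<^sub>v \<psi> t) $ k)) (at t within {0..T})))"

text \<open>Intended for Hermitian matrices, all of whose eigenvalues are real.\<close>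

definition ground_energy :: "complex mat \<Rightarrow> real" where
  "ground_energy A = Min {e. eigenvalue A (complex_of_real e)}"

definition ground_space :: "complex mat \<Rightarrow> complex vec set" where
  "ground_space A =
     {v \<in> carrier_vec (dim_row A). A *\<^sub>v v = complex_of_real (ground_energy A) \<cdot>\<^sub>v v}"

definition orthogonal_projector :: "nat \<Rightarrow> complex mat \<Rightarrow> complex vec set \<Rightarrow> bool" where
  "orthogonal_projector d P V \<longleftrightarrow>
     P \<in> carrier_mat d d \<and> P * P = P \<and> mat_adjoint P = P \<and>
     (\<lambda>v. P *\<^sub>v v) ` carrier_vec d = V"

text \<open>\<open>\<langle>v|A|v\<rangle>\<close>; note that \<open>\<bullet>c\<close> is conjugate linear in its second argument.\<close>

definition expectation :: "complex mat \<Rightarrow> complex vec \<Rightarrow> complex" where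
  "expectation A v = (A *\<^sub>v v) \<bullet>c v"

definition num_ground :: "nat \<Rightarrow> (bool list \<Rightarrow> nat) \<Rightarrow> nat" where
  "num_ground n E = card {s \<in> assignments n. E s = 0}"

definition gamma_const :: "real \<Rightarrow> real \<Rightarrow> real \<Rightarrow> real" where
  "gamma_const N N\<^sub>0 p = p / 2 * ((1 - sqrt (N\<^sub>0 / (N * p)))\<^sup>2 / (1 + sqrt p))"

end

theory Submission
  imports "HOL-Analysis.Henstock_Kurzweil_Integration" Defs
begin

text \<open>
  On a coordinate \<open>k\<close> of zero cost the term \<open>z H\<^sub>f\<close> vanishes whatever the schedule, so
  \<open>\<psi>\<^sub>k' = (\<i> / N) \<Sum>\<^sub>j \<psi>\<^sub>j\<close>, and by conservation of the norm and the Cauchy-Schwarz inequality this has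
  modulus at most \<open>1 / \<surd>N\<close>. Starting from \<open>1 / \<surd>N\<close>, the modulus of \<open>\<psi>\<^sub>k(T)\<close> therefore differs from
  \<open>1 / \<surd>N\<close> by at most \<open>T / \<surd>N\<close>. Summing the squares over the \<open>N\<^sub>0\<close> coordinates of zero cost gives
  \<open>\<bar>\<surd>p - \<surd>(N\<^sub>0 / N)\<bar> \<le> T \<surd>(N\<^sub>0 / N)\<close>. The claim is weaker, because
  \<open>\<gamma> = (\<surd>p - \<surd>(N\<^sub>0 / N))\<^sup>2 / (2 (1 + \<surd>p))\<close> and both square roots lie in \<open>[0, 1]\<close>.
\<close>

\<comment> \<open>frees \<open>$\<close> for the vectors of \<open>Jordan_Normal_Form\<close>\<close>
unbundle no vec_syntax

section \<open>Norm conservation and the speed of a coordinate of zero cost\<close>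

text \<open>A mean value inequality that tolerates the finitely many times at which the schedule may
  jump: the derivative is integrated, and continuity bridges the exceptional points.\<close>

lemma norm_increment_le:
  fixes f :: "real \<Rightarrow> 'a::banach"
  assumes "a \<le> b" "0 \<le> B" "finite S" "continuous_on {a..b} f"
    and deriv: "\<And>t. t \<in> {a..b} - S \<Longrightarrow> (f has_vector_derivative f' t) (at t within {a..b})"
    and bound: "\<And>t. t \<in> {a..b} - S \<Longrightarrow> norm (f' t) \<le> B"
  shows "norm (f b - f a) \<le> B * (b - a)"
proof -
  \<comment> \<open>The endpoints join the exceptional set because only a one-sided derivative is
    known there.\<close>
  have "(f has_vector_derivative f' t) (at t)" if "t \<in> {a..b} - (S \<union> {a, b})" for t
    using deriv[of t] that by (simp add: at_within_Icc_at)
  hence "(f' has_integral (f b - f a)) {a..b}"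
    using assms by (intro fundamental_theorem_of_calculus_strong[of "S \<union> {a, b}"]) auto
  from has_integral_bound_real[OF \<open>0 \<le> B\<close> \<open>finite S\<close> this bound] show ?thesis
    using \<open>a \<le> b\<close> by simp
qed

text \<open>The generator is a rank-one Hermitian matrix plus a real diagonal one, so the evolution
  is unitary. Concretely, the squared norm has derivative zero outside \<open>S\<close>, and
  \<open>norm_increment_le\<close> applies with bound 0.\<close>

lemma norm_conserved:
  fixes u :: "real \<Rightarrow> nat \<Rightarrow> complex" and c :: "real \<Rightarrow> nat \<Rightarrow> real"
  assumes cont: "\<And>k. k < d \<Longrightarrow> continuous_on {0..T} (\<lambda>t. u t k)"
    and fin: "finite S"
    and deriv: "\<And>t k. t \<in> {0..T} - S \<Longrightarrow> k < d \<Longrightarrow>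
      ((\<lambda>t. u t k) has_vector_derivative
        \<i> * ((\<Sum>j<d. u t j) / of_nat d - of_real (c t k) * u t k)) (at t within {0..T})"
    and t: "t \<in> {0..T}"
  shows "(\<Sum>k<d. (cmod (u t k))\<^sup>2) = (\<Sum>k<d. (cmod (u 0 k))\<^sup>2)"
proof -
  let ?g = "\<lambda>t. \<Sum>k<d. u t k * cnj (u t k)"
  let ?v = "\<lambda>t k. \<i> * ((\<Sum>j<d. u t j) / of_nat d - of_real (c t k) * u t k)"
  have g_deriv: "(?g has_vector_derivative 0) (at x within {0..t})" if "x \<in> {0..t} - S" for x
  proof -
    have x: "x \<in> {0..T} - S" using that t by auto
    have "(?g has_vector_derivative (\<Sum>k<d. u x k * cnj (?v x k) + ?v x k * cnj (u x k)))
        (at x within {0..T})"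
      using deriv[OF x]
      by (intro has_vector_derivative_sum has_vector_derivative_mult
          bounded_linear.has_vector_derivative[OF bounded_linear_cnj]) auto
    \<comment> \<open>The diagonal terms cancel within each summand, because \<open>c x k\<close> is
      real.\<close>
    also have "(\<Sum>k<d. u x k * cnj (?v x k) + ?v x k * cnj (u x k)) =
        (\<Sum>k<d. \<i> * ((\<Sum>j<d. u x j) / of_nat d) * cnj (u x k)
          - \<i> * cnj ((\<Sum>j<d. u x j) / of_nat d) * u x k)"
      by (intro sum.cong) (simp_all add: algebra_simps)
    \<comment> \<open>Only after summation over \<open>k\<close> does the rank-one part cancel: both
      products become \<open>\<i>\<close> times the squared modulus of the coordinate sum, divided
      by \<open>d\<close>.\<close>
    also have "\<dots> = \<i> * ((\<Sum>j<d. u x j) / of_nat d) * cnj (\<Sum>k<d. u x k)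
          - \<i> * cnj ((\<Sum>j<d. u x j) / of_nat d) * (\<Sum>k<d. u x k)"
      by (simp only: sum_subtractf cnj_sum sum_distrib_left)
    also have "\<dots> = 0" by simp
    finally show ?thesis
      using t by (auto intro: has_vector_derivative_within_subset)
  qed
  have "continuous_on {0..t} ?g"
    using t by (intro continuous_intros continuous_on_subset[OF cont]) auto
  hence "norm (?g t - ?g 0) \<le> 0 * (t - 0)"
    using t fin g_deriv by (intro norm_increment_le) auto
  hence "?g t = ?g 0" by simp
  hence "complex_of_real (\<Sum>k<d. (cmod (u t k))\<^sup>2) = complex_of_real (\<Sum>k<d. (cmod (u 0 k))\<^sup>2)"
    by (simp only: of_real_sum complex_norm_square)
  thus ?thesis by (simp only: of_real_eq_iff)
qed

lemma zero_cost_drift: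
  fixes u :: "real \<Rightarrow> nat \<Rightarrow> complex" and c :: "real \<Rightarrow> nat \<Rightarrow> real"
  assumes "0 \<le> T"
    and cont: "\<And>k. k < d \<Longrightarrow> continuous_on {0..T} (\<lambda>t. u t k)"
    and fin: "finite S"
    and deriv: "\<And>t k. t \<in> {0..T} - S \<Longrightarrow> k < d \<Longrightarrow>
      ((\<lambda>t. u t k) has_vector_derivative
        \<i> * ((\<Sum>j<d. u t j) / of_nat d - of_real (c t k) * u t k)) (at t within {0..T})"
    and normalized: "(\<Sum>k<d. (cmod (u 0 k))\<^sup>2) = 1"
    and k: "k < d" and zero: "\<And>t. c t k = 0"
  shows "cmod (u T k - u 0 k) \<le> T / sqrt d"
proof -
  have "cmod (\<i> * ((\<Sum>j<d. u t j) / of_nat d - of_real (c t k) * u t k)) \<le> 1 / sqrt d"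
    if t: "t \<in> {0..T} - S" for t
  proof -
    have "(cmod (\<Sum>j<d. u t j))\<^sup>2 \<le> (\<Sum>j<d. cmod (u t j))\<^sup>2"
      by (intro power_mono norm_sum) auto
    also have "\<dots> \<le> (\<Sum>j<d. (cmod (u t j))\<^sup>2) * card {..<d}"
      by (rule sum_squared_le_sum_of_squares)
    also have "(\<Sum>j<d. (cmod (u t j))\<^sup>2) = 1"
      using norm_conserved[of d T u S c t] cont fin deriv t normalized by auto
    finally have "cmod (\<Sum>j<d. u t j) \<le> sqrt d"
      by (simp add: real_le_rsqrt)
    hence "cmod (\<Sum>j<d. u t j) / d \<le> sqrt d / d"
      by (intro divide_right_mono) auto
    also have "sqrt d / d = 1 / sqrt d"
      by (simp add: sqrt_divide_self_eq inverse_eq_divide)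
    finally show ?thesis
      by (simp add: zero norm_mult norm_divide)
  qed
  hence "cmod (u T k - u 0 k) \<le> 1 / sqrt d * (T - 0)"
    using assms by (intro norm_increment_le[where S = S]) auto
  thus ?thesis by simp
qed

section \<open>The Hamiltonian in coordinates\<close>

text \<open>The inverse of the numbering used in \<open>ket\<close>, least significant bit first; it
  turns sums over assignments into sums over indices.\<close>

definition decode :: "nat \<Rightarrow> nat \<Rightarrow> bool list" where
  "decode n i = map (bit i) [0..<n]"

lemma decode_in_assignments: "decode n i \<in> assignments n"
  by (simp add: decode_def assignments_def)

lemma horner_sum_decode: "i < 2 ^ n \<Longrightarrow> horner_sum of_bool 2 (decode n i) = i"
  by (simp add: decode_def horner_sum_bit_eq_take_bit take_bit_nat_eq_self)

lemma decode_horner_sum: "s \<in> assignments n \<Longrightarrow> decode n (horner_sum of_bool 2 s) = s"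
  by (auto simp: decode_def assignments_def bit_horner_sum_bit_iff intro!: nth_equalityI)

lemma bij_betw_decode: "bij_betw (decode n) {..<2 ^ n} (assignments n)"
proof (rule bij_betw_byWitness[where f' = "horner_sum of_bool 2"])
  show "horner_sum of_bool 2 ` assignments n \<subseteq> {..<2 ^ n :: nat}"
    using horner_sum_of_bool_2_less[where 'a = nat] by (auto simp: assignments_def)
qed (auto simp: horner_sum_decode decode_horner_sum decode_in_assignments)

lemma sum_assignments: "(\<Sum>s\<in>assignments n. f s) = (\<Sum>i<2 ^ n. f (decode n i))"
  by (rule sum.reindex_bij_betw[symmetric, OF bij_betw_decode])

lemma ket_decode: "i < 2 ^ n \<Longrightarrow> ket (decode n i) = unit_vec (2 ^ n) i"
  \<comment> \<open>Two passes: \<open>horner_sum_decode\<close> must fire while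
    \<open>decode\<close> is still folded; unfolding it afterwards yields the length
    \<open>n\<close>.\<close>
  by (simp add: ket_def horner_sum_decode) (simp add: decode_def)

lemma uniform_state_eq: "uniform_state n = Matrix.vec (2 ^ n) (\<lambda>_. of_real (1 / sqrt (2 ^ n)))"
  by (rule eq_vecI) (simp_all add: uniform_state_def sum_assignments ket_decode)

lemma cost_hamiltonian_eq:
  "cost_hamiltonian n E = mat_diag (2 ^ n) (\<lambda>i. of_nat (E (decode n i)))"
proof (rule eq_matI)
  fix i j assume "i < dim_row (mat_diag (2 ^ n) (\<lambda>i. of_nat (E (decode n i))) :: complex mat)"
    "j < dim_col (mat_diag (2 ^ n) (\<lambda>i. of_nat (E (decode n i))) :: complex mat)"
  hence ij: "i < 2 ^ n" "j < 2 ^ n" by (auto simp: mat_diag_def)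
  hence "cost_hamiltonian n E $$ (i, j) =
      (\<Sum>k<2 ^ n. of_nat (E (decode n k)) * (of_bool (k = i) * of_bool (k = j)))"
    by (auto simp: cost_hamiltonian_def sum_assignments ket_decode outer_def intro!: sum.cong)
  also have "\<dots> = (\<Sum>k<2 ^ n. if k = i then of_nat (E (decode n k)) * of_bool (k = j) else 0)"
    by (intro sum.cong) auto
  also have "\<dots> = mat_diag (2 ^ n) (\<lambda>i. of_nat (E (decode n i))) $$ (i, j)"
    using ij by (auto simp: mat_diag_def)
  finally show "cost_hamiltonian n E $$ (i, j) = \<dots>" .
qed (simp_all add: cost_hamiltonian_def mat_diag_def)

lemma mat_diag_mult_vec:
  assumes "v \<in> carrier_vec d" "i < d"
  shows "(mat_diag d f *\<^sub>v v) $ i = f i * v $ i"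
  using assms by (auto simp: mat_diag_def scalar_prod_def if_distrib if_distribR cong: if_cong)

text \<open>Brings the Schroedinger equation into the form of \<open>norm_conserved\<close> and
  \<open>zero_cost_drift\<close>, with \<open>d = 2 ^ n\<close> and
  \<open>c t k = z t * E (decode n k)\<close>. The projection onto the uniform state replaces every
  coordinate by the mean of all of them.\<close>

lemma adiabatic_hamiltonian_mult_vec:
  assumes v: "v \<in> carrier_vec (2 ^ n)" and k: "k < 2 ^ n"
  shows "- \<i> * (adiabatic_hamiltonian n E z *\<^sub>v v) $ k =
    \<i> * ((\<Sum>j<2 ^ n. v $ j) / of_nat (2 ^ n) - of_real (z * E (decode n k)) * v $ k)"
proof -
  have sq: "complex_of_real (sqrt (2 ^ n)) * complex_of_real (sqrt (2 ^ n)) = 2 ^ n"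
    by (simp flip: of_real_mult)
  have H0: "initial_hamiltonian n \<in> carrier_mat (2 ^ n) (2 ^ n)"
    by (simp add: initial_hamiltonian_def outer_def uniform_state_def)
  have Hf: "complex_of_real z \<cdot>\<^sub>m cost_hamiltonian n E \<in> carrier_mat (2 ^ n) (2 ^ n)"
    by (simp add: cost_hamiltonian_def)
  have initial: "(initial_hamiltonian n *\<^sub>v v) $ k = - (\<Sum>j<2 ^ n. v $ j) / of_nat (2 ^ n)"
    using v k sq
    by (simp add: initial_hamiltonian_def outer_def uniform_state_eq scalar_prod_def
        atLeast0LessThan sum_negf sum_divide_distrib)
  have "complex_of_real z \<cdot>\<^sub>m cost_hamiltonian n E =
      mat_diag (2 ^ n) (\<lambda>i. of_real (z * E (decode n i)))"
    by (auto simp: cost_hamiltonian_eq mat_diag_def intro!: eq_matI)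
  hence cost: "((complex_of_real z \<cdot>\<^sub>m cost_hamiltonian n E) *\<^sub>v v) $ k =
      of_real (z * E (decode n k)) * v $ k"
    using v k by (simp only: mat_diag_mult_vec)
  have total: "(adiabatic_hamiltonian n E z *\<^sub>v v) $ k =
      (initial_hamiltonian n *\<^sub>v v) $ k + ((complex_of_real z \<cdot>\<^sub>m cost_hamiltonian n E) *\<^sub>v v) $ k"
    using k H0 Hf unfolding adiabatic_hamiltonian_def
    by (subst add_mult_distrib_mat_vec[OF H0 Hf v], subst index_add_vec) auto
  show ?thesis
    unfolding total initial cost by (simp add: algebra_simps del: index_mult_mat_vec)
qed

section \<open>Ground space, projector and success probability in coordinates\<close>

text \<open>Every real eigenvalue is a diagonal entry, which gives both the finiteness that
  \<open>Min\<close> requires and the lower bound 0; the basis vector at \<open>i\<close> attains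
  it.\<close>

lemma ground_energy_mat_diag:
  assumes i: "i < d" and zero: "f i = 0"
  shows "ground_energy (mat_diag d (\<lambda>i. of_nat (f i))) = 0"
  unfolding ground_energy_def
proof (rule Min_eqI)
  let ?A = "mat_diag d (\<lambda>i. of_nat (f i)) :: complex mat"
  have sub: "{e. eigenvalue ?A (complex_of_real e)} \<subseteq> (\<lambda>i. real (f i)) ` {..<d}"
  proof
    fix e assume "e \<in> {e. eigenvalue ?A (complex_of_real e)}"
    then obtain v where v: "v \<in> carrier_vec d" "v \<noteq> 0\<^sub>v d" "?A *\<^sub>v v = of_real e \<cdot>\<^sub>v v"
      by (auto simp: eigenvalue_def eigenvector_def mat_diag_def)
    then obtain k where k: "k < d" "v $ k \<noteq> 0"
      by (metis carrier_vecD eq_vecI index_zero_vec)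
    have "of_nat (f k) * v $ k = complex_of_real e * v $ k"
      using v k mat_diag_mult_vec[OF v(1) k(1), of "\<lambda>i. of_nat (f i)"]
      by (simp del: index_mult_mat_vec)
    hence "complex_of_real (real (f k)) = complex_of_real e" using k by simp
    hence "e = real (f k)" by (simp only: of_real_eq_iff)
    thus "e \<in> (\<lambda>i. real (f i)) ` {..<d}" using k by auto
  qed
  show "finite {e. eigenvalue ?A (complex_of_real e)}"
    using sub by (rule finite_subset) simp
  show "0 \<le> e" if "e \<in> {e. eigenvalue ?A (complex_of_real e)}" for e
    using sub that by auto
  have "?A *\<^sub>v unit_vec d i = 0 \<cdot>\<^sub>v unit_vec d i"
  proof (rule eq_vecI)
    fix k assume "k < dim_vec (0 \<cdot>\<^sub>v unit_vec d i :: complex vec)"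
    thus "(?A *\<^sub>v unit_vec d i) $ k = (0 \<cdot>\<^sub>v unit_vec d i) $ k"
      using i zero by (cases "k = i") (simp_all add: mat_diag_mult_vec del: index_mult_mat_vec)
  qed (simp add: mat_diag_def)
  hence "eigenvector ?A (unit_vec d i) 0"
    using i by (auto simp: eigenvector_def mat_diag_def)
  thus "0 \<in> {e. eigenvalue ?A (complex_of_real e)}"
    by (auto simp: eigenvalue_def)
qed

lemma ground_space_mat_diag:
  assumes "i < d" "f i = 0"
  shows "ground_space (mat_diag d (\<lambda>i. of_nat (f i))) =
    {v \<in> carrier_vec d. \<forall>k<d. f k \<noteq> 0 \<longrightarrow> v $ k = 0}"
proof -
  let ?A = "mat_diag d (\<lambda>i. of_nat (f i)) :: complex mat"
  have dim: "dim_row ?A = d" by (simp add: mat_diag_def)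
  have "(?A *\<^sub>v v = 0 \<cdot>\<^sub>v v) \<longleftrightarrow> (\<forall>k<d. f k \<noteq> 0 \<longrightarrow> v $ k = 0)" if v: "v \<in> carrier_vec d" for v
  proof -
    have "(?A *\<^sub>v v = 0 \<cdot>\<^sub>v v) \<longleftrightarrow> (\<forall>k<d. (?A *\<^sub>v v) $ k = 0)"
      using v dim by (auto simp: vec_eq_iff simp del: index_mult_mat_vec)
    thus ?thesis using v by (auto simp: mat_diag_mult_vec simp del: index_mult_mat_vec)
  qed
  thus ?thesis
    by (auto simp: dim ground_space_def ground_energy_mat_diag[where f = f, OF assms])
qed

text \<open>The abstract conditions determine the matrix. Idempotence makes \<open>P\<close> fix its
  range, which settles the columns in \<open>Z\<close>; the range condition kills the rows outside
  \<open>Z\<close>; self-adjointness carries these zeros over to the columns outside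
  \<open>Z\<close>.\<close>

lemma orthogonal_projector_coordinate_subspace:
  assumes P: "orthogonal_projector d P {v \<in> carrier_vec d. \<forall>k<d. k \<notin> Z \<longrightarrow> v $ k = 0}"
  shows "P = mat_diag d (\<lambda>k. of_bool (k \<in> Z))"
proof (rule eq_matI)
  let ?V = "{v \<in> carrier_vec d. \<forall>k<d. k \<notin> Z \<longrightarrow> v $ k = 0} :: complex vec set"
  have carrier: "P \<in> carrier_mat d d" and idem: "P * P = P" and adj: "mat_adjoint P = P"
    and range: "(\<lambda>v. P *\<^sub>v v) ` carrier_vec d = ?V"
    using P by (auto simp: orthogonal_projector_def)
  have fixed: "P *\<^sub>v v = v" if "v \<in> ?V" for v
  proof -
    have "v \<in> (\<lambda>v. P *\<^sub>v v) ` carrier_vec d" unfolding range by (fact that)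
    then obtain w where w: "v = P *\<^sub>v w" "w \<in> carrier_vec d" by (rule imageE)
    have "P *\<^sub>v v = (P * P) *\<^sub>v w"
      unfolding w(1) by (rule assoc_mult_mat_vec[OF carrier carrier w(2), symmetric])
    thus ?thesis by (simp only: idem w(1))
  qed
  have entry: "P $$ (i, j) = (P *\<^sub>v unit_vec d j) $ i" if "i < d" "j < d" for i j
    using carrier that by simp
  have inside: "P $$ (i, j) = of_bool (i = j)" if ij: "i < d" "j < d" "j \<in> Z" for i j
  proof -
    have "unit_vec d j \<in> ?V" using ij by (auto simp: unit_vec_def)
    from fixed[OF this] show ?thesis using ij by (simp add: entry unit_vec_def del: index_mult_mat_vec)
  qed
  have outside: "P $$ (i, j) = 0" if ij: "i < d" "j < d" "i \<notin> Z" for i j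
  proof -
    have "P *\<^sub>v unit_vec d j \<in> ?V"
      unfolding range[symmetric] by (intro imageI unit_vec_carrier)
    thus ?thesis using ij by (simp add: entry del: index_mult_mat_vec)
  qed
  have hermitian: "P $$ (i, j) = cnj (P $$ (j, i))" if "i < d" "j < d" for i j
  proof -
    have "P $$ (i, j) = mat_adjoint P $$ (i, j)" by (simp add: adj)
    also have "\<dots> = cnj (P $$ (j, i))"
      using carrier that by (simp add: mat_adjoint_def mat_of_rows_def)
    finally show ?thesis .
  qed
  show "dim_row P = dim_row (mat_diag d (\<lambda>k. of_bool (k \<in> Z)) :: complex mat)"
    "dim_col P = dim_col (mat_diag d (\<lambda>k. of_bool (k \<in> Z)) :: complex mat)"
    using carrier by (auto simp: mat_diag_def)
  fix i j assume "i < dim_row (mat_diag d (\<lambda>k. of_bool (k \<in> Z)) :: complex mat)"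
    "j < dim_col (mat_diag d (\<lambda>k. of_bool (k \<in> Z)) :: complex mat)"
  hence ij: "i < d" "j < d" by (auto simp: mat_diag_def)
  have "P $$ (i, j) = (if i = j then of_bool (j \<in> Z) else 0)"
  proof (cases "j \<in> Z")
    case True
    thus ?thesis using inside ij by auto
  next
    case False
    thus ?thesis using outside[OF ij(2,1)] hermitian[OF ij] ij by auto
  qed
  thus "P $$ (i, j) = mat_diag d (\<lambda>k. of_bool (k \<in> Z)) $$ (i, j)"
    using ij by (simp add: mat_diag_def)
qed

lemma expectation_coordinate_projector:
  assumes v: "v \<in> carrier_vec d"
  shows "expectation (mat_diag d (\<lambda>k. of_bool (k \<in> Z))) v =
    of_real (\<Sum>k\<in>{k. k < d \<and> k \<in> Z}. (cmod (v $ k))\<^sup>2)"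
proof -
  let ?Q = "mat_diag d (\<lambda>k. of_bool (k \<in> Z)) :: complex mat"
  have "expectation ?Q v = (\<Sum>k<d. (?Q *\<^sub>v v) $ k * cnj (v $ k))"
    using v by (simp add: expectation_def scalar_prod_def atLeast0LessThan del: index_mult_mat_vec)
  also have "\<dots> = (\<Sum>k<d. if k \<in> Z then of_real ((cmod (v $ k))\<^sup>2) else 0)"
    using v by (intro sum.cong)
      (auto simp: mat_diag_mult_vec complex_norm_square[symmetric] simp del: index_mult_mat_vec)
  also have "\<dots> = (\<Sum>k\<in>{k. k < d \<and> k \<in> Z}. of_real ((cmod (v $ k))\<^sup>2))"
    by (subst sum.inter_filter[symmetric]) auto
  finally show ?thesis by simp
qed

lemma num_ground_eq: "num_ground n E = card {k. k < 2 ^ n \<and> E (decode n k) = 0}"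
proof -
  have "bij_betw (decode n) {k. k < 2 ^ n \<and> E (decode n k) = 0} {s \<in> assignments n. E s = 0}"
    using bij_betw_decode[of n] by (auto simp: bij_betw_def inj_on_def)
  from bij_betw_same_card[OF this] show ?thesis by (simp add: num_ground_def)
qed

section \<open>Bounds on the success probability\<close>

text \<open>Norm conservation gives the first bound. For the second, the drift estimate confines
  each amplitude of zero cost to moduli between \<open>(1 - T) / sqrt (2 ^ n)\<close> and
  \<open>(1 + T) / sqrt (2 ^ n)\<close>; both estimates are then squared and summed.\<close>

lemma success_probability_bounds:
  fixes E :: "bool list \<Rightarrow> nat" and z :: "real \<Rightarrow> real"
  assumes N0_pos: "num_ground n E > 0"
    and T_pos: "T > 0"
    and evolution: "schroedinger_solution (2 ^ n) T (\<lambda>t. adiabatic_hamiltonian n E (z t)) \<psi>"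
    and initial: "\<psi> 0 = uniform_state n"
    and projector: "orthogonal_projector (2 ^ n) P (ground_space (cost_hamiltonian n E))"
    and p_eq: "complex_of_real p = expectation P (\<psi> T)"
  shows "p \<le> 1" and "\<bar>sqrt p - sqrt (num_ground n E / 2 ^ n)\<bar> \<le> T * sqrt (num_ground n E / 2 ^ n)"
proof -
  define G where "G = {k. k < 2 ^ n \<and> E (decode n k) = 0}"
  \<comment> \<open>This is the success probability of the initial state.\<close>
  define r where "r = real (card G) / 2 ^ n"
  have r_nonneg: "0 \<le> r" by (simp add: r_def)
  have card_G: "card G = num_ground n E" by (simp add: G_def num_ground_eq)
  hence "G \<noteq> {}" using N0_pos by auto
  \<comment> \<open>A coordinate of cost 0 is the witness that the ground energy is 0.\<close>
  then obtain i where i: "i < 2 ^ n" "E (decode n i) = 0" by (auto simp: G_def)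
  obtain S where fin: "finite S"
    and carrier: "\<And>t. t \<in> {0..T} \<Longrightarrow> \<psi> t \<in> carrier_vec (2 ^ n)"
    and cont: "\<And>k. k < 2 ^ n \<Longrightarrow> continuous_on {0..T} (\<lambda>t. \<psi> t $ k)"
    and deriv: "\<And>t k. t \<in> {0..T} - S \<Longrightarrow> k < 2 ^ n \<Longrightarrow>
      ((\<lambda>t. \<psi> t $ k) has_vector_derivative
        (- \<i> * (adiabatic_hamiltonian n E (z t) *\<^sub>v \<psi> t) $ k)) (at t within {0..T})"
    using evolution by (auto simp: schroedinger_solution_def)
  have deriv': "((\<lambda>t. \<psi> t $ k) has_vector_derivative
      \<i> * ((\<Sum>j<2 ^ n. \<psi> t $ j) / of_nat (2 ^ n) - of_real (z t * E (decode n k)) * \<psi> t $ k))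
      (at t within {0..T})" if "t \<in> {0..T} - S" "k < 2 ^ n" for t k
    using deriv[OF that] carrier[of t] that by (subst (asm) adiabatic_hamiltonian_mult_vec) auto
  have init: "\<psi> 0 $ k = of_real (1 / sqrt (2 ^ n))" if "k < 2 ^ n" for k
    using that by (simp add: initial uniform_state_eq)
  have normalized: "(\<Sum>k<2 ^ n. (cmod (\<psi> 0 $ k))\<^sup>2) = 1"
    by (simp add: init norm_divide power_divide)
  have "P = mat_diag (2 ^ n) (\<lambda>k. of_bool (k \<in> {k. E (decode n k) = 0}))"
    using projector i
    by (intro orthogonal_projector_coordinate_subspace) (simp add: cost_hamiltonian_eq ground_space_mat_diag)
  hence "complex_of_real p = of_real (\<Sum>k\<in>G. (cmod (\<psi> T $ k))\<^sup>2)"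
    using expectation_coordinate_projector[of "\<psi> T" "2 ^ n" "{k. E (decode n k) = 0}"]
      carrier[of T] T_pos p_eq by (simp add: G_def)
  hence p: "p = (\<Sum>k\<in>G. (cmod (\<psi> T $ k))\<^sup>2)" by (simp only: of_real_eq_iff)
  have "p \<le> (\<Sum>k<2 ^ n. (cmod (\<psi> T $ k))\<^sup>2)"
    unfolding p by (intro sum_mono2) (auto simp: G_def)
  also have "\<dots> = 1"
    using norm_conserved[where u = "\<lambda>t k. \<psi> t $ k", OF cont fin deriv', of T] normalized T_pos by auto
  finally show "p \<le> 1" .
  have drift: "cmod (\<psi> T $ k - of_real (1 / sqrt (2 ^ n))) \<le> T / sqrt (2 ^ n)" if "k \<in> G" for k
    using zero_cost_drift[where u = "\<lambda>t k. \<psi> t $ k", OF _ cont fin deriv' normalized, of k]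
      that T_pos init by (auto simp: G_def)
  have upper: "cmod (\<psi> T $ k) \<le> (1 + T) / sqrt (2 ^ n)"
    and lower: "(1 - T) / sqrt (2 ^ n) \<le> cmod (\<psi> T $ k)" if "k \<in> G" for k
    using drift[OF that] norm_triangle_ineq2[of "\<psi> T $ k" "of_real (1 / sqrt (2 ^ n))"]
      norm_triangle_ineq3[of "\<psi> T $ k" "of_real (1 / sqrt (2 ^ n))"]
    by (simp_all add: norm_divide add_divide_distrib diff_divide_distrib)
  \<comment> \<open>The right-hand side is kept as a square so that comparing it with
    \<open>p\<close> amounts to comparing \<open>sqrt r * x\<close> with
    \<open>sqrt p\<close>.\<close>
  have scale: "(\<Sum>k\<in>G. (x / sqrt (2 ^ n))\<^sup>2) = (sqrt r * x)\<^sup>2" for x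
    by (simp add: r_def power_divide power_mult_distrib)
  have "p \<le> (\<Sum>k\<in>G. ((1 + T) / sqrt (2 ^ n))\<^sup>2)"
    unfolding p by (intro sum_mono power_mono upper) auto
  hence "sqrt p \<le> sqrt r * (1 + T)"
    using T_pos r_nonneg unfolding scale by (intro real_le_lsqrt) simp_all
  moreover have "sqrt r * (1 - T) \<le> sqrt p"
  \<comment> \<open>Squaring the lower bound is monotone only while \<open>1 - T\<close> is
    nonnegative; otherwise the left-hand side is at most 0.\<close>
  proof (cases "T \<le> 1")
    case True
    hence "(\<Sum>k\<in>G. ((1 - T) / sqrt (2 ^ n))\<^sup>2) \<le> p"
      unfolding p by (intro sum_mono power_mono lower) auto
    thus ?thesis unfolding scale by (intro real_le_rsqrt)
  next
    case False
    hence "sqrt r * (1 - T) \<le> 0" by (intro mult_nonneg_nonpos) (auto simp: r_def)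
    also have "0 \<le> sqrt p" by (auto simp: p intro!: sum_nonneg)
    finally show ?thesis .
  qed
  ultimately have "\<bar>sqrt p - sqrt r\<bar> \<le> T * sqrt r"
    by (simp add: abs_le_iff algebra_simps)
  thus "\<bar>sqrt p - sqrt (num_ground n E / 2 ^ n)\<bar> \<le> T * sqrt (num_ground n E / 2 ^ n)"
    by (simp add: r_def card_G)
qed

section \<open>The time bound and the asymptotics of \<open>\<gamma>\<close>\<close>

lemma num_ground_le: "num_ground n E \<le> 2 ^ n"
  using card_mono[of "{..<2 ^ n}" "{k. k < 2 ^ n \<and> E (decode n k) = 0}"]
  by (auto simp: num_ground_eq)

text \<open>Absorbing the factor \<open>p\<close> into the square exposes the difference of square
  roots that \<open>success_probability_bounds\<close> controls.\<close>

lemma gamma_const_eq: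
  assumes "p > 0"
  shows "gamma_const N M p = (sqrt p - sqrt (M / N))\<^sup>2 / (2 * (1 + sqrt p))"
proof -
  have "1 - sqrt (M / (N * p)) = (sqrt p - sqrt (M / N)) / sqrt p"
    using assms by (simp add: real_sqrt_divide real_sqrt_mult field_simps)
  thus ?thesis using assms by (simp add: gamma_const_def power_divide)
qed

text \<open>All data form a family indexed by \<open>n\<close>, which gives the order statement a
  meaning. Since \<open>\<gamma>\<close> vanishes when \<open>p\<close> equals
  \<open>N\<^sub>0 / N\<close>, its lower bound is stated under conditions that eventually keep
  these two apart.\<close>

theorem lemma2:
  fixes E :: "nat \<Rightarrow> bool list \<Rightarrow> nat"
    and m :: "nat \<Rightarrow> nat"
    and z :: "nat \<Rightarrow> real \<Rightarrow> real"
    and T :: "nat \<Rightarrow> real"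
    and \<psi> :: "nat \<Rightarrow> real \<Rightarrow> complex vec"
    and P :: "nat \<Rightarrow> complex mat"
    and p :: "nat \<Rightarrow> real"
    and N\<^sub>0 :: "nat \<Rightarrow> nat"
    and \<gamma> :: "nat \<Rightarrow> real"
  assumes poly_m: "\<exists>k. (\<lambda>n. real (m n)) \<in> O(\<lambda>n. real n ^ k)"
    and cost_range: "\<And>n s. n \<ge> 1 \<Longrightarrow> s \<in> assignments n \<Longrightarrow> E n s \<in> {0..m n}"
    and N0_eq: "\<And>n. n \<ge> 1 \<Longrightarrow> N\<^sub>0 n = num_ground n (E n)"
    and N0_pos: "\<And>n. n \<ge> 1 \<Longrightarrow> N\<^sub>0 n > 0"
    and T_pos: "\<And>n. n \<ge> 1 \<Longrightarrow> T n > 0"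
    and evolution: "\<And>n. n \<ge> 1 \<Longrightarrow>
      schroedinger_solution (2 ^ n) (T n) (\<lambda>t. adiabatic_hamiltonian n (E n) (z n t)) (\<psi> n)"
    and initial: "\<And>n. n \<ge> 1 \<Longrightarrow> \<psi> n 0 = uniform_state n"
    and projector: "\<And>n. n \<ge> 1 \<Longrightarrow>
      orthogonal_projector (2 ^ n) (P n) (ground_space (cost_hamiltonian n (E n)))"
    and p_eq: "\<And>n. n \<ge> 1 \<Longrightarrow> complex_of_real (p n) = expectation (P n) (\<psi> n (T n))"
    and p_pos: "\<And>n. n \<ge> 1 \<Longrightarrow> p n > 0"
    and gamma_eq: "\<And>n. n \<ge> 1 \<Longrightarrow> \<gamma> n = gamma_const (2 ^ n) (real (N\<^sub>0 n)) (p n)"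
  shows "(\<forall>n\<ge>1. sqrt (2 ^ n / real (N\<^sub>0 n)) * \<gamma> n \<le> T n) \<and>
    \<gamma> \<in> O(\<lambda>_. 1) \<and>
    (p \<in> \<Omega>(\<lambda>_. 1) \<longrightarrow> (\<lambda>n. real (N\<^sub>0 n) / 2 ^ n) \<in> o(\<lambda>_. 1) \<longrightarrow> \<gamma> \<in> \<Theta>(\<lambda>_. 1))"
proof (intro conjI impI allI)
  define r where "r n = real (N\<^sub>0 n) / 2 ^ n" for n
  have p_le: "p n \<le> 1" and close: "\<bar>sqrt (p n) - sqrt (r n)\<bar> \<le> T n * sqrt (r n)" if "n \<ge> 1" for n
    using success_probability_bounds[OF _ T_pos[OF that] evolution[OF that] initial[OF that]
        projector[OF that] p_eq[OF that]] N0_pos[OF that] N0_eq[OF that] by (simp_all add: r_def)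
  have r_pos: "r n > 0" if "n \<ge> 1" for n
    using N0_pos[OF that] by (simp add: r_def)
  have r_le: "r n \<le> 1" if "n \<ge> 1" for n
  proof -
    have "real (N\<^sub>0 n) \<le> real (2 ^ n)"
      unfolding N0_eq[OF that] of_nat_le_iff by (rule num_ground_le)
    thus ?thesis by (simp add: r_def)
  qed
  have gamma: "\<gamma> n = (sqrt (p n) - sqrt (r n))\<^sup>2 / (2 * (1 + sqrt (p n)))" if "n \<ge> 1" for n
    using gamma_eq[OF that] gamma_const_eq[OF p_pos[OF that]] by (simp add: r_def)
  have diff_le: "\<bar>sqrt (p n) - sqrt (r n)\<bar> \<le> 1" if "n \<ge> 1" for n
  proof -
    have "sqrt (p n) \<le> 1" "sqrt (r n) \<le> 1" "0 \<le> sqrt (p n)" "0 \<le> sqrt (r n)"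
      using p_le[OF that] r_le[OF that] p_pos[OF that] r_pos[OF that] by auto
    thus ?thesis by linarith
  qed
  \<comment> \<open>One factor of the square is bounded by 1 and the denominator is at least 1; what
    remains is linear in the difference, as in \<open>close\<close>.\<close>
  have gamma_le: "\<gamma> n \<le> \<bar>sqrt (p n) - sqrt (r n)\<bar>" if "n \<ge> 1" for n
  proof -
    let ?x = "\<bar>sqrt (p n) - sqrt (r n)\<bar>"
    have "\<gamma> n = ?x * ?x / (2 * (1 + sqrt (p n)))"
      by (simp add: gamma[OF that] power2_eq_square)
    also have "\<dots> \<le> ?x * 1 / 1"
      using diff_le[OF that] p_pos[OF that] by (intro frac_le mult_left_mono) auto
    finally show ?thesis by simp
  qed
  have gamma_nonneg: "0 \<le> \<gamma> n" if "n \<ge> 1" for n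
    using p_pos[OF that] by (simp add: gamma[OF that])
  show "sqrt (2 ^ n / real (N\<^sub>0 n)) * \<gamma> n \<le> T n" if n: "1 \<le> n" for n
  proof -
    have "\<gamma> n \<le> T n * sqrt (r n)"
      using gamma_le[OF n] close[OF n] by linarith
    hence "\<gamma> n / sqrt (r n) \<le> T n"
      using r_pos[OF n] by (simp add: field_simps)
    thus ?thesis by (simp add: r_def real_sqrt_divide field_simps)
  qed
  show bounded: "\<gamma> \<in> O(\<lambda>_. 1)"
  proof (rule bigoI[where c = 1])
    show "\<forall>\<^sub>F n in at_top. norm (\<gamma> n) \<le> 1 * norm (1 :: real)"
      using eventually_ge_at_top[of 1]
    proof eventually_elim
      case (elim n)
      thus ?case using gamma_le[of n] diff_le[of n] gamma_nonneg[of n] by simp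
    qed
  qed
  assume "p \<in> \<Omega>(\<lambda>_. 1)" and r_small: "(\<lambda>n. real (N\<^sub>0 n) / 2 ^ n) \<in> o(\<lambda>_. 1)"
  then obtain c where c: "c > 0" "\<forall>\<^sub>F n in at_top. norm (p n) \<ge> c * norm (1 :: real)"
    by (elim landau_omega.bigE)
  \<comment> \<open>With \<open>c / 4\<close>, \<open>sqrt (r n)\<close> is at most half of
    \<open>sqrt c\<close>, the lower bound for \<open>sqrt (p n)\<close>.\<close>
  have "\<forall>\<^sub>F n in at_top. norm (r n) \<le> c / 4 * norm (1 :: real)"
    using landau_o.smallD[OF r_small, of "c / 4"] c by (simp add: r_def)
  with c(2) eventually_ge_at_top[of 1]
  \<comment> \<open>The constant is \<open>c / 4\<close> from the squared difference, over 4, which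
    bounds the denominator because \<open>sqrt (p n)\<close> is at most 1.\<close>
  have "\<forall>\<^sub>F n in at_top. norm (\<gamma> n) \<ge> c / 16 * norm (1 :: real)"
  proof eventually_elim
    case (elim n)
    have "sqrt c \<le> sqrt (p n)" "sqrt (r n) \<le> sqrt (c / 4)" "sqrt (p n) \<le> 1"
      using elim p_pos[of n] r_pos[of n] p_le[of n] by auto
    moreover have "sqrt (c / 4) = sqrt c / 2" by (simp add: real_sqrt_divide)
    ultimately have "sqrt c / 2 \<le> sqrt (p n) - sqrt (r n)" by linarith
    hence "(sqrt c / 2)\<^sup>2 \<le> (sqrt (p n) - sqrt (r n))\<^sup>2"
      using c by (intro power_mono) auto
    hence "c / 4 \<le> (sqrt (p n) - sqrt (r n))\<^sup>2"
      using c by (simp add: power_divide)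
    hence "c / 4 / 4 \<le> (sqrt (p n) - sqrt (r n))\<^sup>2 / (2 * (1 + sqrt (p n)))"
      using c \<open>sqrt (p n) \<le> 1\<close> p_pos[of n] elim
      by (intro frac_le) (auto intro!: add_pos_nonneg)
    hence "c / 16 \<le> \<gamma> n" using gamma[of n] elim by simp
    thus ?case by simp
  qed
  hence "\<gamma> \<in> \<Omega>(\<lambda>_. 1)" using c by (intro landau_omega.bigI[of "c / 16"]) auto
  thus "\<gamma> \<in> \<Theta>(\<lambda>_. 1)" using bounded by (simp add: bigtheta_def)
qed

end
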